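(* Let $p$ be a prime, $M=M[A]$ a simple, coloopless, 3-connected $p$-matroid on ground set $E$ with $|E|>4$, $a,b\in E$ distinct, $\alpha\in GF(p)$ nonzero, $e\in\{a,b\}$. Then the $es$-splitting matroid $M^e_{a,b}$ is 3-connected.
   Context: A $p$-matroid is a matroid representable over $GF(p)$, $A$ a representing matrix over $GF(p)$ with columns indexed by $E$. $A'_{a,b}$ is obtained from $A$ by appending a last row with $\alpha$ in columns $a,b$ and $0$ elsewhere, then a column $z$ with last coordinate $\alpha$ and $0$ elsewhere. $A^e_{a,b}$ is obtained from $A'_{a,b}$ by appending a column $\gamma$ = (column of $e$) $-$ (column $z$); $M^e_{a,b}$ is the vector matroid of $A^e_{a,b}$ on $E\cup\{z,\gamma\}$. A $k$-separation of a matroid $N$ with rank function $r$ is a partition $\{S,T\}$ of its ground set with $|S|,|T|\ge k$ and $r(S)+r(T)-r(N)<k$; $N$ is 3-connected if it has no $1$- or $2$-separation. *)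

theory Defs
  imports "HOL-Analysis.Analysis" "Berlekamp_Zassenhaus.Finite_Field"
begin

record 'e matroid =
  ground :: "'e set"
  indep :: "'e set \<Rightarrow> bool"

definition is_matroid :: "'e matroid \<Rightarrow> bool" where
  "is_matroid M \<longleftrightarrow>
     finite (ground M) \<and>
     (\<forall>X. indep M X \<longrightarrow> X \<subseteq> ground M) \<and>
     indep M {} \<and>
     (\<forall>X Y. indep M X \<and> Y \<subseteq> X \<longrightarrow> indep M Y) \<and>
     (\<forall>X Y. indep M X \<and> indep M Y \<and> card X < card Y \<longrightarrow>
        (\<exists>y\<in>Y - X. indep M (insert y X)))"

definition rank_of :: "'e matroid \<Rightarrow> 'e set \<Rightarrow> nat" where
  "rank_of M S = Max {card I | I. I \<subseteq> S \<and> indep M I}"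

definition basis_of :: "'e matroid \<Rightarrow> 'e set \<Rightarrow> bool" where
  "basis_of M B \<longleftrightarrow> indep M B \<and> (\<forall>I. indep M I \<and> B \<subseteq> I \<longrightarrow> I = B)"

definition circuit :: "'e matroid \<Rightarrow> 'e set \<Rightarrow> bool" where
  "circuit M C \<longleftrightarrow> C \<subseteq> ground M \<and> \<not> indep M C \<and> (\<forall>D. D \<subset> C \<longrightarrow> indep M D)"

definition loop :: "'e matroid \<Rightarrow> 'e \<Rightarrow> bool" where
  "loop M x \<longleftrightarrow> circuit M {x}"

definition parallel :: "'e matroid \<Rightarrow> 'e \<Rightarrow> 'e \<Rightarrow> bool" where
  "parallel M x y \<longleftrightarrow> x \<noteq> y \<and> circuit M {x, y}"

definition simple_matroid :: "'e matroid \<Rightarrow> bool" where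
  "simple_matroid M \<longleftrightarrow> (\<nexists>x. loop M x) \<and> (\<nexists>x y. parallel M x y)"

definition coloop :: "'e matroid \<Rightarrow> 'e \<Rightarrow> bool" where
  "coloop M x \<longleftrightarrow> x \<in> ground M \<and> (\<forall>B. basis_of M B \<longrightarrow> x \<in> B)"

definition coloopless :: "'e matroid \<Rightarrow> bool" where
  "coloopless M \<longleftrightarrow> (\<nexists>x. coloop M x)"

definition k_separation :: "nat \<Rightarrow> 'e matroid \<Rightarrow> 'e set \<Rightarrow> 'e set \<Rightarrow> bool" where
  "k_separation k M S T \<longleftrightarrow>
     S \<union> T = ground M \<and> S \<inter> T = {} \<and> card S \<ge> k \<and> card T \<ge> k \<and>
     int (rank_of M S) + int (rank_of M T) - int (rank_of M (ground M)) < int k"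

definition three_connected :: "'e matroid \<Rightarrow> bool" where
  "three_connected M \<longleftrightarrow>
     (\<nexists>S T. k_separation 1 M S T) \<and> (\<nexists>S T. k_separation 2 M S T)"

text \<open>
  The ground set is the type of column labels. A set of labels is independent if the
  corresponding columns, as an indexed family, are linearly independent; hence the injectivity
  condition, which makes labels of equal columns dependent.
\<close>

definition vector_matroid :: "'k::field ^ 'e ^ 'r \<Rightarrow> 'e matroid" where
  "vector_matroid A =
     \<lparr> ground = UNIV,
       indep = (\<lambda>S. inj_on (\<lambda>j. column j A) S \<and> vec.independent ((\<lambda>j. column j A) ` S)) \<rparr>"

text \<open>An appended row or column gets the new label \<open>None\<close>; an old label \<open>x\<close> becomes \<open>Some x\<close>.\<close>

definition append_row :: "'k ^ 'n ^ 'm \<Rightarrow> 'k ^ 'n \<Rightarrow> 'k ^ 'n ^ ('m option)" where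
  "append_row A v = (\<chi> i. case i of None \<Rightarrow> v | Some i' \<Rightarrow> A $ i')"

definition append_col :: "'k ^ 'n ^ 'm \<Rightarrow> 'k ^ 'm \<Rightarrow> 'k ^ ('n option) ^ 'm" where
  "append_col A v = (\<chi> i j. case j of None \<Rightarrow> v $ i | Some j' \<Rightarrow> A $ i $ j')"

text \<open>The matrix $A'_{a,b}$: its column \<open>None\<close> is $z$.\<close>

definition splitting_matrix ::
    "'k::field ^ 'e ^ 'r \<Rightarrow> 'e \<Rightarrow> 'e \<Rightarrow> 'k \<Rightarrow> 'k ^ ('e option) ^ ('r option)" where
  "splitting_matrix A a b \<alpha> =
     append_col (append_row A (\<chi> j. if j = a \<or> j = b then \<alpha> else 0))
       (\<chi> i. if i = None then \<alpha> else 0)"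

text \<open>
  The matrix $A^e_{a,b}$: its column \<open>None\<close> is $\gamma$, its column \<open>Some None\<close> is $z$, and
  \<open>Some (Some x)\<close> is the column of the original element \<open>x\<close>.
\<close>

definition es_splitting_matrix ::
    "'k::field ^ 'e ^ 'r \<Rightarrow> 'e \<Rightarrow> 'e \<Rightarrow> 'e \<Rightarrow> 'k \<Rightarrow> 'k ^ ('e option option) ^ ('r option)" where
  "es_splitting_matrix A a b e \<alpha> =
     (let A' = splitting_matrix A a b \<alpha>
      in append_col A' (column (Some e) A' - column None A'))"

definition es_splitting ::
    "'k::field ^ 'e ^ 'r \<Rightarrow> 'e \<Rightarrow> 'e \<Rightarrow> 'e \<Rightarrow> 'k \<Rightarrow> 'e option option matroid" where
  "es_splitting A a b e \<alpha> = vector_matroid (es_splitting_matrix A a b e \<alpha>)"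

lemma is_matroid_vector_matroid: "is_matroid (vector_matroid A)"
proof -
  let ?c = "\<lambda>j. column j A"
  have aug: "\<exists>y\<in>Y - X. inj_on ?c (insert y X) \<and> vec.independent (?c ` insert y X)"
    if X: "inj_on ?c X" "vec.independent (?c ` X)"
      and Y: "inj_on ?c Y" "vec.independent (?c ` Y)"
      and less: "card X < card Y" for X Y
  proof -
    have "\<not> ?c ` Y \<subseteq> vec.span (?c ` X)"
    proof
      assume "?c ` Y \<subseteq> vec.span (?c ` X)"
      then have "card (?c ` Y) \<le> card (?c ` X)"
        using vec.independent_span_bound[of "?c ` X" "?c ` Y"] Y(2) by simp
      then show False using X(1) Y(1) less by (simp add: card_image)
    qed
    then obtain y where y: "y \<in> Y" "?c y \<notin> vec.span (?c ` X)" by blast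
    have "?c y \<notin> ?c ` X"
      using y(2) by (rule contrapos_nn) (rule vec.span_base)
    then have "inj_on ?c (insert y X)" and "y \<notin> X"
      using X(1) by (simp_all add: inj_on_insert inj_on_diff imageI) auto
    moreover have "vec.independent (?c ` insert y X)"
      unfolding image_insert using y(2) X(2) by (rule vec.independent_insertI)
    ultimately show ?thesis
      using y(1) by (intro bexI[of _ y] conjI DiffI)
  qed
  have sub: "inj_on ?c Y \<and> vec.independent (?c ` Y)"
    if X: "inj_on ?c X \<and> vec.independent (?c ` X)" and "Y \<subseteq> X" for X Y
    using inj_on_subset[OF conjunct1[OF X] \<open>Y \<subseteq> X\<close>]
      vec.independent_mono[OF conjunct2[OF X] image_mono[OF \<open>Y \<subseteq> X\<close>]] by (rule conjI)
  have emp: "inj_on ?c {} \<and> vec.independent (?c ` {})"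
    by (simp add: vec.independent_empty)
  show ?thesis
    unfolding is_matroid_def vector_matroid_def matroid.simps
  proof (intro conjI allI impI)
    fix X Y assume "(inj_on ?c X \<and> vec.independent (?c ` X)) \<and> Y \<subseteq> X"
    then show "inj_on ?c Y" "vec.independent (?c ` Y)"
      using sub[of X Y] by simp_all
  next
    fix X Y
    assume "(inj_on ?c X \<and> vec.independent (?c ` X)) \<and>
      (inj_on ?c Y \<and> vec.independent (?c ` Y)) \<and> card X < card Y"
    then show "\<exists>y\<in>Y - X. inj_on ?c (insert y X) \<and> vec.independent (?c ` insert y X)"
      by (intro aug) simp_all
  qed (use emp in simp_all)
qed

end

theory Submission
  imports Defs
begin

text \<open>
  Deleting the last coordinate maps the columns of $A^e_{a,b}$ onto those of $A$, sending $\gamma$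
  to $e$ and $z$ to $0$. Hence a set $S$ of columns has rank at least that of its image $\pi S$ in
  $M$, and exactly one more as soon as its span contains $z$. Let $\{S,T\}$ be a partition with
  $z \in T$. Then $\pi S \cup \pi T = E$, and in a 3-connected matroid
  $r(X) + r(Y) \ge r(M) + \min(2,|X|,|Y|)$ for every cover $X \cup Y = E$, disjoint or not, because
  $X$ and $Y$ can be shrunk to a partition without lowering this minimum if $|E| \ge 4$. If $z$
  is spanned by $S$, the ranks of $S$ and of $T$ both gain one over those of the images, which makes
  up for $\pi T$ having fewer elements than $T$. Otherwise $S$ contains neither
  $\{e,\gamma\}$, since $z = e - \gamma$, nor $E - e$, since deleting $\{a,b\}$ does not
  lower the rank of $M$. Then $|\pi S| = |S|$ and $\pi T$ contains $e$ and a second element.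
\<close>

section \<open>Rank and 3-connectedness\<close>

lemma
  assumes "is_matroid M"
  shows rank_of_mono: "S \<subseteq> T \<Longrightarrow> rank_of M S \<le> rank_of M T"
    and rank_of_le_card: "finite S \<Longrightarrow> rank_of M S \<le> card S"
proof -
  let ?K = "\<lambda>S. {card I | I. I \<subseteq> S \<and> indep M I}"
  have "indep M {}" and "finite (ground M)" and "\<And>I. indep M I \<Longrightarrow> I \<subseteq> ground M"
    using assms by (auto simp: is_matroid_def)
  then have nonempty: "?K S \<noteq> {}" and subset: "?K S \<subseteq> {..card (ground M)}" for S
    by (auto intro: card_mono)
  have finite: "finite (?K S)" for S
    by (rule finite_subset[OF subset finite_atMost])
  show "rank_of M S \<le> rank_of M T" if "S \<subseteq> T"
    unfolding rank_of_def using that by (intro Max_mono nonempty finite) blast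
  show "rank_of M S \<le> card S" if "finite S"
    unfolding rank_of_def using that
    by (subst Max_le_iff[OF finite nonempty]) (auto intro: card_mono)
qed

lemma three_connected_iff:
  assumes "finite (ground M)"
  shows "three_connected M \<longleftrightarrow>
    (\<forall>S T. S \<union> T = ground M \<longrightarrow> S \<inter> T = {} \<longrightarrow>
      rank_of M (ground M) + min 2 (min (card S) (card T)) \<le> rank_of M S + rank_of M T)"
    (is "_ \<longleftrightarrow> (\<forall>S T. _ \<longrightarrow> _ \<longrightarrow> ?conn S T)")
proof (intro iffI allI impI)
  fix S T
  assume conn: "three_connected M" and partition: "S \<union> T = ground M" "S \<inter> T = {}"
  have sep: "rank_of M (ground M) + k \<le> rank_of M S + rank_of M T"
    if "k \<in> {1, 2}" "k \<le> card S" "k \<le> card T" for k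
  proof -
    have "\<not> k_separation k M S T" using conn that(1) by (auto simp: three_connected_def)
    then show ?thesis using partition that(2,3) by (simp add: k_separation_def)
  qed
  have "finite S" "finite T"
    using assms by (simp_all flip: partition(1))
  then consider (empty) "S = {} \<or> T = {}"
    | (singleton) "min (card S) (card T) = 1"
    | (large) "2 \<le> min (card S) (card T)"
    by (metis One_nat_def Suc_1 card_0_eq less_2_cases_iff min_def not_le)
  then show "?conn S T"
  proof cases
    case empty
    then show ?thesis using partition by auto
  next
    case singleton
    then show ?thesis using sep[of 1] by simp
  next
    case large
    then show ?thesis using sep[of 2] by simp
  qed
next
  assume conn: "\<forall>S T. S \<union> T = ground M \<longrightarrow> S \<inter> T = {} \<longrightarrow> ?conn S T"
  have "\<not> k_separation k M S T" if "k \<in> {1, 2}" for k S T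
  proof
    assume sep: "k_separation k M S T"
    then have "?conn S T" using conn by (simp add: k_separation_def)
    moreover have "k \<le> min 2 (min (card S) (card T))"
      using that sep by (auto simp: k_separation_def)
    moreover have "int (rank_of M S) + int (rank_of M T) - int (rank_of M (ground M)) < int k"
      using sep by (simp add: k_separation_def)
    ultimately show False by linarith
  qed
  then show "three_connected M" by (simp add: three_connected_def)
qed

lemma three_connected_rank_of_cover:
  assumes matroid: "is_matroid M" and conn: "three_connected M"
    and ground: "4 \<le> card (ground M)" and cover: "X \<union> Y = ground M"
  shows "rank_of M (ground M) + min 2 (min (card X) (card Y)) \<le> rank_of M X + rank_of M Y"
proof -
  let ?E = "ground M"
  have fin: "finite ?E" using matroid by (simp add: is_matroid_def)
  have subsets: "?E - Y \<subseteq> X" "X \<subseteq> ?E" "Y \<subseteq> ?E" using cover by auto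
  then have "finite X" and card_Y: "card (?E - Y) = card ?E - card Y" "card Y \<le> card ?E"
    using fin by (auto simp: card_Diff_subset card_mono finite_subset)
  define n where "n = max (card (?E - Y)) (min 2 (card X))"
  have "n \<le> card X"
    using card_mono[OF \<open>finite X\<close> subsets(1)] by (simp add: n_def)
  then obtain Z where Z: "?E - Y \<subseteq> Z" "Z \<subseteq> X" "card Z = n"
    using exists_subset_between[OF _ _ subsets(1) \<open>finite X\<close>, of n] n_def by auto
  then have "Z \<subseteq> ?E" "?E - Z \<subseteq> Y" using subsets(2) by auto
  then have "card (?E - Z) = card ?E - n"
    using Z(3) fin by (simp add: card_Diff_subset finite_subset)
  then have "min 2 (min (card X) (card Y)) \<le> min 2 (min (card Z) (card (?E - Z)))"
    using ground card_Y Z(3) unfolding n_def by linarith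
  then have "rank_of M ?E + min 2 (min (card X) (card Y))
      \<le> rank_of M ?E + min 2 (min (card Z) (card (?E - Z)))"
    by (rule add_left_mono)
  also have "\<dots> \<le> rank_of M Z + rank_of M (?E - Z)"
    using three_connected_iff[OF fin, THEN iffD1, OF conn, rule_format, of Z "?E - Z"]
      \<open>Z \<subseteq> ?E\<close> by (simp add: Un_absorb1)
  also have "\<dots> \<le> rank_of M X + rank_of M Y"
    using Z(2) \<open>?E - Z \<subseteq> Y\<close> by (intro add_mono rank_of_mono[OF matroid])
  finally show ?thesis .
qed

lemma three_connected_rank_of_Diff:
  assumes matroid: "is_matroid M" and conn: "three_connected M"
    and ground: "4 \<le> card (ground M)" and X: "X \<subseteq> ground M" "card X \<le> 2"
  shows "rank_of M (ground M - X) = rank_of M (ground M)"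
proof (rule antisym)
  show "rank_of M (ground M - X) \<le> rank_of M (ground M)"
    by (intro rank_of_mono[OF matroid]) blast
  have "finite X" using matroid X(1) by (auto simp: is_matroid_def intro: finite_subset)
  then have "card X \<le> card (ground M - X)" using ground X by (simp add: card_Diff_subset)
  then show "rank_of M (ground M) \<le> rank_of M (ground M - X)"
    using three_connected_rank_of_cover[OF matroid conn ground, of X "ground M - X"]
      rank_of_le_card[OF matroid \<open>finite X\<close>] X by (simp add: Un_absorb1)
qed

section \<open>Vector matroids\<close>

definition column_span :: "'k::field ^ 'n ^ 'm \<Rightarrow> 'n set \<Rightarrow> ('k ^ 'm) set" where
  "column_span A S = vec.span ((\<lambda>j. column j A) ` S)"

lemma subspace_column_span: "vec.subspace (column_span A S)"
  by (simp add: column_span_def)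

lemma column_in_column_span: "j \<in> S \<Longrightarrow> column j A \<in> column_span A S"
  by (simp add: column_span_def vec.span_base)

lemma column_span_mono: "S \<subseteq> T \<Longrightarrow> column_span A S \<subseteq> column_span A T"
  by (simp add: column_span_def vec.span_mono image_mono)

lemma column_span_subset_subspace:
  "vec.subspace V \<Longrightarrow> (\<And>j. j \<in> S \<Longrightarrow> column j A \<in> V) \<Longrightarrow> column_span A S \<subseteq> V"
  unfolding column_span_def by (intro vec.span_minimal) auto

lemma ground_vector_matroid [simp]: "ground (vector_matroid A) = UNIV"
  by (simp add: vector_matroid_def)

lemma rank_of_vector_matroid:
  fixes A :: "'k::field ^ 'e::finite ^ 'r::finite"
  shows "rank_of (vector_matroid A) S = vec.dim (column_span A S)"
proof -
  let ?c = "\<lambda>j. column j A"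
  let ?K = "{card I | I. I \<subseteq> S \<and> indep (vector_matroid A) I}"
  have indep: "indep (vector_matroid A) I \<longleftrightarrow> inj_on ?c I \<and> vec.independent (?c ` I)" for I
    by (simp add: vector_matroid_def)
  have "finite ?K" by simp
  moreover have "n \<le> vec.dim (?c ` S)" if "n \<in> ?K" for n
  proof -
    from that obtain I where I: "n = card I" "I \<subseteq> S" "inj_on ?c I" "vec.independent (?c ` I)"
      using indep by blast
    then show ?thesis
      using vec.independent_card_le_dim[of "?c ` I" "?c ` S"] by (simp add: image_mono card_image)
  qed
  moreover have "vec.dim (?c ` S) \<in> ?K"
  proof -
    obtain B where B: "B \<subseteq> ?c ` S" "vec.independent B" "card B = vec.dim (?c ` S)"
      using vec.basis_exists[of "?c ` S"] by metis
    obtain I where I: "I \<subseteq> S" "inj_on ?c I" "B = ?c ` I"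
      using B(1) by (meson subset_image_inj)
    then show ?thesis using B indep by (auto simp: card_image intro!: exI[of _ I])
  qed
  ultimately have "rank_of (vector_matroid A) S = vec.dim (?c ` S)"
    unfolding rank_of_def by (intro Max_eqI) auto
  then show ?thesis by (simp add: column_span_def)
qed

section \<open>Dropping a coordinate\<close>

lemma (in finite_dimensional_vector_space_pair_1) dim_eq_Suc_dim_image:
  assumes f: "Vector_Spaces.linear s1 s2 f" and kernel: "\<And>w. f w = 0 \<Longrightarrow> w \<in> vs1.span {z}"
    and z: "z \<noteq> 0" "f z = 0" "z \<in> vs1.span X"
  shows "vs1.dim X = Suc (vs2.dim (f ` X))"
proof -
  obtain B where B: "{z} \<subseteq> B" "B \<subseteq> vs1.span X" "vs1.independent B" "vs1.span X \<subseteq> vs1.span B"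
    using vs1.maximal_independent_subset_extend[of "{z}" "vs1.span X"] z by auto
  define C where "C = B - {z}"
  have BC: "B = insert z C" using B(1) by (auto simp: C_def)
  have span_B: "vs1.span B = vs1.span X"
    using B by (simp add: subset_antisym vs1.span_minimal)
  have z_C: "z \<notin> vs1.span C"
    using B(1,3) by (auto simp: C_def vs1.dependent_def)
  have "inj_on f (vs1.span C)"
  proof (subst linear_inj_on_iff_eq_0[OF f vs1.subspace_span], intro ballI impI)
    fix w assume w: "w \<in> vs1.span C" "f w = 0"
    then obtain k where k: "w = k *a z"
      using kernel by (auto simp: vs1.span_singleton)
    have "k = 0"
    proof (rule ccontr)
      assume "k \<noteq> 0"
      then have "z = inverse k *a w" by (simp add: k)
      then show False using z_C w(1) vs1.span_scale by blast
    qed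
    then show "w = 0" by (simp add: k)
  qed
  then have "vs2.dim (f ` C) = vs1.dim C" by (rule dim_image_eq[OF f])
  moreover have "vs2.span (f ` X) = vs2.span (f ` C)"
    using span_B by (metis BC f image_insert linear_span_image vs2.span_insert_0 z(2))
  then have "vs2.dim (f ` X) = vs2.dim (f ` C)" by (rule vs2.span_eq_dim)
  moreover have "vs1.dim X = Suc (vs1.dim C)"
    using vs1.span_eq_dim[OF span_B] z_C by (simp add: BC vs1.dim_insert)
  ultimately show ?thesis by simp
qed

definition restrict_vec :: "'k ^ 'r option \<Rightarrow> 'k ^ 'r" where
  "restrict_vec w = (\<chi> i. w $ Some i)"

lemma linear_restrict_vec:
  "Vector_Spaces.linear (*s) (*s) (restrict_vec :: 'k::field ^ 'r option \<Rightarrow> 'k ^ 'r)"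
  by unfold_locales (simp_all add: restrict_vec_def vec_eq_iff algebra_simps)

lemma vec_option_eq_iff: "v = w \<longleftrightarrow> v $ None = w $ None \<and> restrict_vec v = restrict_vec w"
  by (auto simp: restrict_vec_def vec_eq_iff) (metis option.exhaust)

lemma restrict_vec_axis_None [simp]: "restrict_vec (axis None c) = 0"
  by (simp add: restrict_vec_def axis_def vec_eq_iff)

lemma dim_restrict_vec_le:
  fixes X :: "('k::field ^ 'r::finite option) set"
  shows "vec.dim (restrict_vec ` X) \<le> vec.dim X"
  by (rule vec.dim_image_le[OF linear_restrict_vec])

lemma dim_eq_Suc_dim_restrict_vec:
  fixes X :: "('k::field ^ 'r::finite option) set"
  assumes "c \<noteq> 0" and "axis None c \<in> vec.span X"
  shows "vec.dim X = Suc (vec.dim (restrict_vec ` X))"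
proof (rule vec.dim_eq_Suc_dim_image[OF linear_restrict_vec _ _ _ assms(2)])
  fix w :: "'k ^ 'r option"
  assume "restrict_vec w = 0"
  then have "w = (w $ None / c) *s axis None c"
    using assms(1) by (simp add: vec_option_eq_iff) (simp add: restrict_vec_def axis_def vec_eq_iff)
  then show "w \<in> vec.span {axis None c}"
    by (metis rangeI vec.span_singleton)
qed (use assms(1) in \<open>simp_all add: axis_eq_0_iff\<close>)

section \<open>The es-splitting matrix\<close>

lemma column_None_es_splitting_matrix:
  "column None (es_splitting_matrix A a b e \<alpha>) =
     column (Some (Some e)) (es_splitting_matrix A a b e \<alpha>) - axis None \<alpha>"
  by (simp add: vec_eq_iff column_def axis_def es_splitting_matrix_def splitting_matrix_def
      append_col_def)

lemma column_Some_None_es_splitting_matrix: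
  "column (Some None) (es_splitting_matrix A a b e \<alpha>) = axis None \<alpha>"
  by (simp add: vec_eq_iff column_def axis_def es_splitting_matrix_def splitting_matrix_def
      append_col_def)

lemma column_Some_Some_es_splitting_matrix_nth_None:
  "column (Some (Some x)) (es_splitting_matrix A a b e \<alpha>) $ None = (if x \<in> {a, b} then \<alpha> else 0)"
  by (simp add: column_def es_splitting_matrix_def splitting_matrix_def append_col_def
      append_row_def)

lemma restrict_vec_column_es_splitting_matrix:
  "restrict_vec (column (Some (Some x)) (es_splitting_matrix A a b e \<alpha>)) = column x A"
  by (simp add: vec_eq_iff restrict_vec_def column_def es_splitting_matrix_def
      splitting_matrix_def append_col_def append_row_def)

text \<open>Contracting $z$ makes $\gamma$ parallel to $e$.\<close>

definition merge_gamma :: "'e \<Rightarrow> 'e option option set \<Rightarrow> 'e set" where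
  "merge_gamma e S = {x. Some (Some x) \<in> S \<or> x = e \<and> None \<in> S}"

lemma merge_gamma_Un: "merge_gamma e (S \<union> T) = merge_gamma e S \<union> merge_gamma e T"
  by (auto simp: merge_gamma_def)

lemma merge_gamma_UNIV [simp]: "merge_gamma e UNIV = UNIV"
  by (simp add: merge_gamma_def)

lemma merge_gamma_empty_iff: "merge_gamma e S = {} \<longleftrightarrow> S \<subseteq> {Some None}"
  by (auto simp: merge_gamma_def) (metis option.exhaust)

lemma card_le_card_merge_gamma:
  fixes S :: "'e::finite option option set"
  assumes "Some None \<notin> S" and "Some (Some e) \<notin> S \<or> None \<notin> S"
  shows "card S \<le> card (merge_gamma e S)"
proof (rule surj_card_le)
  let ?g = "\<lambda>x. if Some (Some x) \<in> S then Some (Some x) else None"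
  show "S \<subseteq> ?g ` merge_gamma e S"
  proof
    fix j assume "j \<in> S"
    let ?x = "case j of Some (Some x) \<Rightarrow> x | _ \<Rightarrow> e"
    have "j = ?g ?x" and "?x \<in> merge_gamma e S"
      using \<open>j \<in> S\<close> assms by (auto simp: merge_gamma_def split: option.splits)
    then show "j \<in> ?g ` merge_gamma e S" by blast
  qed
qed simp

lemma restrict_vec_column_span:
  "restrict_vec ` column_span (es_splitting_matrix A a b e \<alpha>) S = column_span A (merge_gamma e S)"
proof -
  let ?d = "\<lambda>j. column j (es_splitting_matrix A a b e \<alpha>)"
  have "restrict_vec (?d None) = column e A"
    by (simp add: column_None_es_splitting_matrix restrict_vec_column_es_splitting_matrix
        vec.linear_diff[OF linear_restrict_vec])
  then have restrict: "restrict_vec (?d j) =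
      (case j of None \<Rightarrow> column e A | Some None \<Rightarrow> 0 | Some (Some x) \<Rightarrow> column x A)" for j
    by (auto simp: column_Some_None_es_splitting_matrix restrict_vec_column_es_splitting_matrix
        split: option.splits)
  have "insert 0 (restrict_vec ` ?d ` S) = insert 0 ((\<lambda>x. column x A) ` merge_gamma e S)"
    unfolding image_image restrict
    by (force simp: merge_gamma_def image_iff split: option.splits)
  then show ?thesis
    unfolding column_span_def vec.linear_span_image[OF linear_restrict_vec, symmetric]
    by (metis vec.span_insert_0)
qed

lemma rank_of_es_splitting_ge:
  fixes A :: "'k::field ^ 'e::finite ^ 'r::finite"
  shows "rank_of (vector_matroid A) (merge_gamma e S) \<le> rank_of (es_splitting A a b e \<alpha>) S"
  unfolding es_splitting_def rank_of_vector_matroid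
    restrict_vec_column_span[of A a b e \<alpha>, symmetric]
  by (rule dim_restrict_vec_le)

lemma rank_of_es_splitting_eq:
  fixes A :: "'k::field ^ 'e::finite ^ 'r::finite"
  assumes "\<alpha> \<noteq> 0" and "axis None \<alpha> \<in> column_span (es_splitting_matrix A a b e \<alpha>) S"
  shows "rank_of (es_splitting A a b e \<alpha>) S = Suc (rank_of (vector_matroid A) (merge_gamma e S))"
  unfolding es_splitting_def rank_of_vector_matroid
    restrict_vec_column_span[of A a b e \<alpha>, symmetric]
  using assms by (intro dim_eq_Suc_dim_restrict_vec vec.span_base)

section \<open>Column sets that span z\<close>

lemma axis_None_in_column_span_of_e_gamma:
  assumes "Some (Some e) \<in> S" and "None \<in> S"
  shows "axis None \<alpha> \<in> column_span (es_splitting_matrix A a b e \<alpha>) S"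
proof -
  have "axis None \<alpha> = column (Some (Some e)) (es_splitting_matrix A a b e \<alpha>) -
      column None (es_splitting_matrix A a b e \<alpha>)"
    by (simp add: column_None_es_splitting_matrix)
  also have "\<dots> \<in> column_span (es_splitting_matrix A a b e \<alpha>) S"
    using assms by (intro vec.subspace_diff subspace_column_span column_in_column_span)
  finally show ?thesis .
qed

lemma axis_None_in_column_span_of_spanning_Compl:
  fixes A :: "'k::field ^ 'e::finite ^ 'r::finite"
  assumes f: "f \<in> {a, b}"
    and rank: "rank_of (vector_matroid A) (- {a, b}) = rank_of (vector_matroid A) UNIV"
    and S: "Some (Some f) \<in> S" "\<And>x. x \<notin> {a, b} \<Longrightarrow> Some (Some x) \<in> S"
  shows "axis None \<alpha> \<in> column_span (es_splitting_matrix A a b e \<alpha>) S"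
proof -
  let ?A' = "es_splitting_matrix A a b e \<alpha>"
  let ?U = "(Some \<circ> Some) ` (- {a, b})"
  have "column_span A (- {a, b}) = column_span A UNIV"
    using rank unfolding rank_of_vector_matroid
    by (intro vec.subspace_dim_equal subspace_column_span column_span_mono) simp_all
  moreover have "merge_gamma e ?U = - {a, b}"
    by (auto simp: merge_gamma_def)
  ultimately have "column f A \<in> restrict_vec ` column_span ?A' ?U"
    by (simp add: restrict_vec_column_span column_in_column_span)
  then obtain w where w: "w \<in> column_span ?A' ?U" "restrict_vec w = column f A" by auto
  have "column_span ?A' ?U \<subseteq> {w. w $ None = 0}"
    by (intro column_span_subset_subspace)
      (auto simp: vec.subspace_def column_Some_Some_es_splitting_matrix_nth_None split: if_splits)
  then have "w $ None = 0" using w(1) by blast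
  then have "axis None \<alpha> = column (Some (Some f)) ?A' - w"
    using f w(2) by (simp add: vec_option_eq_iff column_Some_Some_es_splitting_matrix_nth_None
        restrict_vec_column_es_splitting_matrix vec.linear_diff[OF linear_restrict_vec])
  moreover have "w \<in> column_span ?A' S"
    using w(1) S(2) column_span_mono[of ?U S] by (auto simp: subset_iff)
  ultimately show ?thesis
    using S(1) by (simp add: vec.subspace_diff subspace_column_span column_in_column_span)
qed

section \<open>3-connectedness of the es-splitting matroid\<close>

lemma two_le_card_merge_gamma_if_not_spanned:
  fixes A :: "'k::field ^ 'e::finite ^ 'r::finite"
  assumes conn: "three_connected (vector_matroid A)" "4 \<le> CARD('e)"
    and "a \<noteq> b" "e \<in> {a, b}" and cover: "S \<union> T = UNIV"
    and not_spanned: "axis None \<alpha> \<notin> column_span (es_splitting_matrix A a b e \<alpha>) S"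
  shows "2 \<le> card (merge_gamma e T)"
proof -
  have "rank_of (vector_matroid A) (- {a, b}) = rank_of (vector_matroid A) UNIV"
    using three_connected_rank_of_Diff[OF is_matroid_vector_matroid conn(1), of "{a, b}"] conn(2)
      \<open>a \<noteq> b\<close> by (simp add: Compl_eq_Diff_UNIV)
  moreover obtain f where "{a, b} = {e, f}" "e \<noteq> f" using \<open>a \<noteq> b\<close> \<open>e \<in> {a, b}\<close> by auto
  ultimately obtain y where y: "y \<noteq> e" "Some (Some y) \<notin> S"
    using not_spanned axis_None_in_column_span_of_spanning_Compl[of f a b A S] by (metis insertCI)
  moreover have "Some (Some e) \<notin> S \<or> None \<notin> S"
    using not_spanned axis_None_in_column_span_of_e_gamma by blast
  ultimately have "{e, y} \<subseteq> merge_gamma e T"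
    using cover by (auto simp: merge_gamma_def)
  then show ?thesis
    using card_mono[of "merge_gamma e T" "{e, y}"] y(1) by simp
qed

lemma rank_of_es_splitting_partition:
  fixes A :: "'k::field ^ 'e::finite ^ 'r::finite"
  assumes conn: "three_connected (vector_matroid A)" "4 \<le> CARD('e)"
    and "a \<noteq> b" and \<alpha>: "\<alpha> \<noteq> 0" and "e \<in> {a, b}"
    and partition: "S \<union> T = UNIV" "S \<inter> T = {}" and z: "Some None \<in> T"
  defines "N \<equiv> es_splitting A a b e \<alpha>"
  shows "rank_of N UNIV + min 2 (min (card S) (card T)) \<le> rank_of N S + rank_of N T"
proof -
  let ?r = "rank_of (vector_matroid A)" and ?\<pi> = "merge_gamma e"
    and ?span = "column_span (es_splitting_matrix A a b e \<alpha>)"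
  have "axis None \<alpha> \<in> ?span X" if "Some None \<in> X" for X
    using column_in_column_span[OF that, of "es_splitting_matrix A a b e \<alpha>"]
    by (simp add: column_Some_None_es_splitting_matrix)
  then have rank_UNIV: "rank_of N UNIV = Suc (?r UNIV)" and rank_T: "rank_of N T = Suc (?r (?\<pi> T))"
    using z by (simp_all add: N_def rank_of_es_splitting_eq \<alpha>)
  have "?\<pi> S \<union> ?\<pi> T = UNIV"
    using partition(1) by (simp flip: merge_gamma_Un)
  then have cover: "?r UNIV + min 2 (min (card (?\<pi> S)) (card (?\<pi> T))) \<le> ?r (?\<pi> S) + ?r (?\<pi> T)"
    using three_connected_rank_of_cover[OF is_matroid_vector_matroid conn(1)] conn(2) by simp
  show ?thesis
  proof (cases "axis None \<alpha> \<in> ?span S")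
    case True
    have "1 \<le> card (?\<pi> S)" if "1 \<le> card S"
      using that z partition(2) by (auto simp: Suc_le_eq card_gt_0_iff merge_gamma_empty_iff)
    moreover have "1 \<le> card (?\<pi> T)" if "2 \<le> card T"
      using that card_mono[of "{Some None}" T]
      by (auto simp: Suc_le_eq card_gt_0_iff merge_gamma_empty_iff)
    ultimately have "min 2 (min (card S) (card T)) \<le> 1 + min 2 (min (card (?\<pi> S)) (card (?\<pi> T)))"
      by linarith
    then show ?thesis
      using cover rank_UNIV rank_T rank_of_es_splitting_eq[OF \<alpha> True] by (simp add: N_def)
  next
    case False
    then have "Some (Some e) \<notin> S \<or> None \<notin> S"
      using axis_None_in_column_span_of_e_gamma by blast
    then have "card S \<le> card (?\<pi> S)"
      using z partition(2) by (intro card_le_card_merge_gamma) auto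
    moreover have "2 \<le> card (?\<pi> T)"
      by (rule two_le_card_merge_gamma_if_not_spanned
          [OF conn \<open>a \<noteq> b\<close> \<open>e \<in> {a, b}\<close> partition(1) False])
    ultimately show ?thesis
      using cover rank_UNIV rank_T rank_of_es_splitting_ge[of A e S a b \<alpha>] by (simp add: N_def)
  qed
qed

theorem three_connected_es_splitting:
  fixes A :: "'k::field ^ 'e::finite ^ 'r::finite"
  assumes "three_connected (vector_matroid A)" and "4 \<le> CARD('e)"
    and "a \<noteq> b" and "\<alpha> \<noteq> 0" and "e \<in> {a, b}"
  shows "three_connected (es_splitting A a b e \<alpha>)"
proof -
  let ?N = "es_splitting A a b e \<alpha>"
  have "rank_of ?N UNIV + min 2 (min (card S) (card T)) \<le> rank_of ?N S + rank_of ?N T"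
    if "S \<union> T = UNIV" "S \<inter> T = {}" for S T
  proof (cases "Some None \<in> T")
    case True
    then show ?thesis using assms that by (intro rank_of_es_splitting_partition)
  next
    case False
    then have "Some None \<in> S" "T \<union> S = UNIV" "T \<inter> S = {}" using that by auto
    then show ?thesis
      using rank_of_es_splitting_partition[OF assms, of T S] by (simp add: ac_simps)
  qed
  then show ?thesis
    by (subst three_connected_iff) (simp_all add: es_splitting_def)
qed

theorem theorem3p4:
  fixes p :: nat
    and A :: "'p::prime_card mod_ring ^ 'e::finite ^ 'r::finite"
    and M :: "'e matroid"
    and a b e :: 'e
    and \<alpha> :: "'p mod_ring"
  assumes "prime p" and "CARD('p) = p"
    and "M = vector_matroid A"
    and "simple_matroid M" and "coloopless M" and "three_connected M"
    and "card (ground M) > 4"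
    and "a \<noteq> b" and "\<alpha> \<noteq> 0" and "e \<in> {a, b}"
  shows "three_connected (es_splitting A a b e \<alpha>)"
  using assms by (intro three_connected_es_splitting) simp_all

end
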